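(* Let $A\in\mathbb R^{m\times k}$, $B\in\mathbb R^{k\times n}$, and let $T$ be a full binary tree with leaves $1,\dots,k$. For each internal node $v$ let $S_v\subseteq\{1,\dots,k\}$ be the set of leaves below $v$ and $Q_v=A_{:,S_v}B_{S_v,:}$. Define $$G=(A^\top A)\circ(BB^\top),\qquad G_{\ell r}=\bigl((A_{:,\ell})^\top A_{:,r}\bigr)\bigl(B_{\ell,:}(B_{r,:})^\top\bigr).$$ Then $$\sum_{v\in\operatorname{int}(T)}\|Q_v\|_F^2=\langle K_T,G\rangle,$$ and the product-leaf scale $\mathcal P(A,B)=\sum_{\ell=1}^k\|A_{:,\ell}\|_2^2\|B_{\ell,:}\|_2^2$ equals $\operatorname{tr}(G)$.
   Context: A full binary tree is one in which every internal node has exactly two children; $\operatorname{int}(T)$ is its set of internal nodes. $K_T$ is the common-ancestor kernel, the $k\times k$ matrix with $(K_T)_{ij}=\#\{v\in\operatorname{int}(T): i,j\in S_v\}$. $\circ$ is the Hadamard (entrywise) product and $\langle X,Y\rangle=\operatorname{tr}(X^\top Y)$. $A_{:,S}$ denotes the submatrix of columns of $A$ indexed by $S$, $B_{S,:}$ the submatrix of rows of $B$ indexed by $S$. *)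

theory Defs
  imports Complex_Main "Jordan_Normal_Form.Matrix" "Jordan_Normal_Form.DL_Submatrix"
begin

section \<open>Full binary trees\<close>

datatype 'a fbtree = Leaf 'a | Node "'a fbtree" "'a fbtree"

primrec leaf_labels :: "'a fbtree \<Rightarrow> 'a list" where
  "leaf_labels (Leaf a) = [a]"
| "leaf_labels (Node l r) = leaf_labels l @ leaf_labels r"

text \<open>
  Matrices are indexed from 0, so the leaves 1, ..., k are rendered as 0, ..., k - 1.
  A tree has at least one leaf, hence this predicate implies k > 0.
\<close>

definition is_fbtree_on :: "nat \<Rightarrow> nat fbtree \<Rightarrow> bool" where
  "is_fbtree_on k T \<longleftrightarrow> distinct (leaf_labels T) \<and> set (leaf_labels T) = {0..<k}"

text \<open>
  A node is identified with the path leading to it from the root (False = left, True = right).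
\<close>

primrec internal_nodes :: "'a fbtree \<Rightarrow> bool list set" where
  "internal_nodes (Leaf a) = {}"
| "internal_nodes (Node l r) =
     insert [] ((#) False ` internal_nodes l \<union> (#) True ` internal_nodes r)"

text \<open>The third equation concerns only paths that leave the tree; its value is immaterial.\<close>

fun subtree_at :: "'a fbtree \<Rightarrow> bool list \<Rightarrow> 'a fbtree" where
  "subtree_at T [] = T"
| "subtree_at (Node l r) (b # bs) = subtree_at (if b then r else l) bs"
| "subtree_at (Leaf a) (b # bs) = Leaf a"

definition leaves_below :: "'a fbtree \<Rightarrow> bool list \<Rightarrow> 'a set" where
  "leaves_below T v = set (leaf_labels (subtree_at T v))"

section \<open>Matrix notions\<close>

definition mat_trace :: "real mat \<Rightarrow> real" where
  "mat_trace X = (\<Sum>i<dim_row X. X $$ (i, i))"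

definition frob_inner :: "real mat \<Rightarrow> real mat \<Rightarrow> real" where
  "frob_inner X Y = mat_trace (transpose_mat X * Y)"

definition frob_norm :: "real mat \<Rightarrow> real" where
  "frob_norm X = sqrt (\<Sum>i<dim_row X. \<Sum>j<dim_col X. (X $$ (i, j))\<^sup>2)"

definition l2_norm :: "real vec \<Rightarrow> real" where
  "l2_norm x = sqrt (\<Sum>i<dim_vec x. (x $ i)\<^sup>2)"

definition hadamard :: "real mat \<Rightarrow> real mat \<Rightarrow> real mat" where
  "hadamard X Y = mat (dim_row X) (dim_col X) (\<lambda>(i, j). X $$ (i, j) * Y $$ (i, j))"

section \<open>Tree-structured matrix products\<close>

definition ancestor_kernel :: "nat \<Rightarrow> nat fbtree \<Rightarrow> real mat" where
  "ancestor_kernel k T = mat k k (\<lambda>(i, j).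
     real (card {v \<in> internal_nodes T. i \<in> leaves_below T v \<and> j \<in> leaves_below T v}))"

definition node_product :: "real mat \<Rightarrow> real mat \<Rightarrow> nat fbtree \<Rightarrow> bool list \<Rightarrow> real mat" where
  "node_product A B T v =
     submatrix A UNIV (leaves_below T v) * submatrix B (leaves_below T v) UNIV"

definition product_gram :: "real mat \<Rightarrow> real mat \<Rightarrow> real mat" where
  "product_gram A B = hadamard (transpose_mat A * A) (B * transpose_mat B)"

definition product_leaf_scale :: "real mat \<Rightarrow> real mat \<Rightarrow> real" where
  "product_leaf_scale A B = (\<Sum>l<dim_col A. (l2_norm (col A l))\<^sup>2 * (l2_norm (row B l))\<^sup>2)"

end

(*
  Expanding the square of (Q_v)_{ij} = sum_{l in S_v} A_{il} B_{lj} and summing over i, j first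
  turns |Q_v|_F^2 into the sum of G_{lr} over all l, r in S_v. Summing over v, each G_{lr} is
  counted once per internal node below which both l and r lie, that is (K_T)_{lr} times.
*)

theory Submission
  imports Defs
begin

text \<open>\<open>submatrix\<close> addresses its entries through \<open>pick S\<close>; this
  bijection turns sums over positions into sums over \<open>S\<close>. Counting the elements of
  \<open>S\<close> below a given one inverts \<open>pick S\<close>, and equal cardinalities then
  give surjectivity.\<close>

lemma bij_betw_pick:
  assumes "finite S"
  shows "bij_betw (pick S) {..<card S} S"
proof -
  have "inj_on (pick S) {..<card S}"
    by (rule inj_on_inverseI[where g = "\<lambda>i. card {a \<in> S. a < i}"]) (simp add: card_pick)
  moreover have "pick S ` {..<card S} \<subseteq> S"
    by (auto intro: pick_in_set)
  ultimately show ?thesis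
    using assms by (simp add: bij_betw_def card_image card_subset_eq)
qed

text \<open>The columns of \<open>A\<close> and the rows of \<open>B\<close> are renumbered by the
  same \<open>pick S\<close>, so the product can be summed over the original indices.\<close>

lemma submatrix_cols_times_rows:
  fixes A B :: "'a::semiring_0 mat"
  assumes A: "A \<in> carrier_mat m k" and B: "B \<in> carrier_mat k n" and S: "S \<subseteq> {..<k}"
  shows "submatrix A UNIV S * submatrix B S UNIV
    = mat m n (\<lambda>(i, j). \<Sum>l\<in>S. A $$ (i, l) * B $$ (l, j))"
proof -
  \<comment> \<open>The cardinality of the left-hand set is the inner dimension that
    \<open>submatrix\<close> produces.\<close>
  have set_S: "{l. l < k \<and> l \<in> S} = S"
    using S by auto
  have "(\<Sum>q<card S. A $$ (i, pick S q) * B $$ (pick S q, j)) = (\<Sum>l\<in>S. A $$ (i, l) * B $$ (l, j))"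
    for i j
    using sum.reindex_bij_betw[OF bij_betw_pick[OF finite_subset[OF S finite_lessThan]]] .
  with A B show ?thesis
    by (intro eq_matI)
       (auto simp: submatrix_def set_S pick_UNIV scalar_prod_def lessThan_atLeast0)
qed

lemma frob_norm_square:
  "(frob_norm X)\<^sup>2 = (\<Sum>i<dim_row X. \<Sum>j<dim_col X. (X $$ (i, j))\<^sup>2)"
  by (simp add: frob_norm_def sum_nonneg)

lemma l2_norm_square: "(l2_norm x)\<^sup>2 = x \<bullet> x"
  by (simp add: l2_norm_def sum_nonneg scalar_prod_def power2_eq_square lessThan_atLeast0)

lemma product_gram_carrier:
  assumes "A \<in> carrier_mat m k"
  shows "product_gram A B \<in> carrier_mat k k"
  using assms by (simp add: product_gram_def hadamard_def)

lemma product_gram_index: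
  assumes "A \<in> carrier_mat m k" "B \<in> carrier_mat k n" "l < k" "r < k"
  shows "product_gram A B $$ (l, r) = (col A l \<bullet> col A r) * (row B l \<bullet> row B r)"
  using assms by (simp add: product_gram_def hadamard_def)

lemma frob_norm_cols_times_rows:
  assumes A: "A \<in> carrier_mat m k" and B: "B \<in> carrier_mat k n" and S: "S \<subseteq> {..<k}"
  shows "(frob_norm (submatrix A UNIV S * submatrix B S UNIV))\<^sup>2
    = (\<Sum>l\<in>S. \<Sum>r\<in>S. product_gram A B $$ (l, r))"
proof -
  let ?f = "\<lambda>i j l r. (A $$ (i, l) * A $$ (i, r)) * (B $$ (l, j) * B $$ (r, j))"
  have "(frob_norm (submatrix A UNIV S * submatrix B S UNIV))\<^sup>2
      = (\<Sum>i<m. \<Sum>j<n. \<Sum>l\<in>S. \<Sum>r\<in>S. ?f i j l r)"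
    unfolding frob_norm_square submatrix_cols_times_rows[OF A B S]
    by (simp add: power2_eq_square sum_product mult_ac)
  also have "\<dots> = (\<Sum>l\<in>S. \<Sum>r\<in>S. \<Sum>i<m. \<Sum>j<n. ?f i j l r)"
    \<comment> \<open>With both index sets fixed, \<open>sum.swap\<close> rewrites in one direction
      only and carries the sums over \<open>S\<close> outward.\<close>
    by (simp add: sum.swap[of _ S "{..<n}"] sum.swap[of _ S "{..<m}"])
  also have "\<dots> = (\<Sum>l\<in>S. \<Sum>r\<in>S. product_gram A B $$ (l, r))"
  proof (intro sum.cong refl)
    fix l r
    assume "l \<in> S" "r \<in> S"
    then have "l < k" "r < k"
      using S by auto
    then show "(\<Sum>i<m. \<Sum>j<n. ?f i j l r) = product_gram A B $$ (l, r)"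
      using A B
      by (simp add: product_gram_index[OF A B] scalar_prod_def sum_product lessThan_atLeast0)
  qed
  finally show ?thesis .
qed

lemma finite_internal_nodes: "finite (internal_nodes T)"
  by (induction T) auto

text \<open>Each step descends to a child, and a path that runs past a leaf stays at it.\<close>

lemma leaf_labels_subtree_at: "set (leaf_labels (subtree_at T v)) \<subseteq> set (leaf_labels T)"
  by (induction T v rule: subtree_at.induct) (auto split: if_splits)

lemma leaves_below_subset:
  assumes "is_fbtree_on k T"
  shows "leaves_below T v \<subseteq> {..<k}"
  using assms leaf_labels_subtree_at[of T v]
  by (auto simp: is_fbtree_on_def leaves_below_def)

lemma frob_inner_eq_sum:
  assumes "X \<in> carrier_mat m n" "Y \<in> carrier_mat m n"
  shows "frob_inner X Y = (\<Sum>i<m. \<Sum>j<n. X $$ (i, j) * Y $$ (i, j))"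
proof -
  \<comment> \<open>The trace adds up the inner products of the \<open>j\<close>-th columns, so the
    column index comes out first.\<close>
  have "frob_inner X Y = (\<Sum>j<n. \<Sum>i<m. X $$ (i, j) * Y $$ (i, j))"
    using assms
    by (simp add: frob_inner_def mat_trace_def scalar_prod_def lessThan_atLeast0)
  then show ?thesis
    by (subst sum.swap)
qed

lemma frob_inner_ancestor_kernel:
  assumes T: "is_fbtree_on k T" and Y: "Y \<in> carrier_mat k k"
  shows "frob_inner (ancestor_kernel k T) Y
    = (\<Sum>v\<in>internal_nodes T. \<Sum>l\<in>leaves_below T v. \<Sum>r\<in>leaves_below T v. Y $$ (l, r))"
proof -
  let ?S = "leaves_below T" and ?V = "internal_nodes T"
  let ?g = "\<lambda>v l r. if l \<in> ?S v \<and> r \<in> ?S v then Y $$ (l, r) else 0"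
  have restrict: "(\<Sum>l<k. if l \<in> ?S v then f l else 0) = (\<Sum>l\<in>?S v. f l)"
    for v and f :: "nat \<Rightarrow> real"
    using leaves_below_subset[OF T, of v]
    by (simp add: sum.inter_restrict[symmetric] Int_absorb1)
  have "frob_inner (ancestor_kernel k T) Y = (\<Sum>l<k. \<Sum>r<k. ancestor_kernel k T $$ (l, r) * Y $$ (l, r))"
    using Y by (intro frob_inner_eq_sum) (simp_all add: ancestor_kernel_def)
  \<comment> \<open>A kernel entry is the cardinality of a set of nodes, hence a sum of indicators
    over the finite set \<open>?V\<close>.\<close>
  also have "\<dots> = (\<Sum>l<k. \<Sum>r<k. \<Sum>v\<in>?V. ?g v l r)"
    by (simp add: ancestor_kernel_def finite_internal_nodes sum.inter_filter[symmetric])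
  also have "\<dots> = (\<Sum>v\<in>?V. \<Sum>l<k. \<Sum>r<k. ?g v l r)"
    by (simp only: sum.swap[of _ ?V])
  \<comment> \<open>Nesting the two conditions lets \<open>restrict\<close> act on each sum
    separately.\<close>
  also have "\<dots> = (\<Sum>v\<in>?V. \<Sum>l<k. if l \<in> ?S v then \<Sum>r<k. if r \<in> ?S v then Y $$ (l, r) else 0 else 0)"
    by (intro sum.cong refl) auto
  finally show ?thesis
    by (simp only: restrict)
qed

theorem proposition4p3:
  fixes A B :: "real mat" and m k n :: nat and T :: "nat fbtree"
  assumes "A \<in> carrier_mat m k"
    and "B \<in> carrier_mat k n"
    and "is_fbtree_on k T"
  shows "(\<forall>l<k. \<forall>r<k. product_gram A B $$ (l, r) = (col A l \<bullet> col A r) * (row B l \<bullet> row B r))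
    \<and> (\<Sum>v\<in>internal_nodes T. (frob_norm (node_product A B T v))\<^sup>2)
         = frob_inner (ancestor_kernel k T) (product_gram A B)
    \<and> product_leaf_scale A B = mat_trace (product_gram A B)"
proof (intro conjI allI impI)
  show "product_gram A B $$ (l, r) = (col A l \<bullet> col A r) * (row B l \<bullet> row B r)"
    if "l < k" "r < k" for l r
    using product_gram_index[OF assms(1,2) that] .
  show "(\<Sum>v\<in>internal_nodes T. (frob_norm (node_product A B T v))\<^sup>2)
      = frob_inner (ancestor_kernel k T) (product_gram A B)"
    \<comment> \<open>Both sides become the sum over \<open>v\<close> of the entries of
      \<open>product_gram A B\<close> with both indices in \<open>leaves_below T v\<close>.\<close>
    by (simp add: node_product_def frob_inner_ancestor_kernel[OF assms(3) product_gram_carrier[OF assms(1)]]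
        frob_norm_cols_times_rows[OF assms(1,2) leaves_below_subset[OF assms(3)]])
  show "product_leaf_scale A B = mat_trace (product_gram A B)"
    \<comment> \<open>On the diagonal both inner products are squared norms.\<close>
    using assms(1) product_gram_carrier[OF assms(1), of B]
    by (simp add: product_leaf_scale_def mat_trace_def l2_norm_square product_gram_index[OF assms(1,2)])
qed

end
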